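(* Let $\alpha\in\mathbb{R}$, $\alpha\neq0$. The isentropic gas dynamics system $$\partial_t\rho+\partial_x(\rho u)=0,\qquad \partial_t(\rho u)+\partial_x(\rho u^2)+\partial_xp=0,\qquad p=\frac\alpha3\rho^3,\qquad x\in\mathbb{R},\ t>0,$$ can be rewritten, with $m=\rho u$, as the following bi-Hamiltonian structure: $$\frac{\partial}{\partial t}\begin{pmatrix}\rho \\ m\end{pmatrix}=\tilde J\begin{pmatrix}\frac{\delta H_1^m}{\delta\rho}\\[2pt] \frac{\delta H_1^m}{\delta m}\end{pmatrix}=\tilde K\begin{pmatrix}\frac{\delta H_2^m}{\delta\rho}\\[2pt] \frac{\delta H_2^m}{\delta m}\end{pmatrix},$$ where $\tilde J$ and $\tilde K$ are the anti-symmetric operators $$\tilde J=\begin{pmatrix}-\frac1\alpha\partial_x&-\frac1\alpha\partial_xu \\ -\frac1\alpha u\partial_x&-\frac1\alpha u\partial_xu-\rho\partial_x\rho\end{pmatrix},\qquad \tilde K=\begin{pmatrix}0&-\partial_x\rho \\ -\rho\partial_x&-u\partial_x\rho-\rho\partial_xu\end{pmatrix},$$ and the Hamiltonians are $$H_1^m(\rho,m)=\int_{\mathbb{R}}\Big(\frac{m^3}{6\rho^3}+\frac\alpha2m\rho\Big)dx,\qquad H_2^m(\rho,m)=\int_{\mathbb{R}}\Big(\frac{m^2}{2\rho}+\frac\alpha6\rho^3\Big)dx.$$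
   Context: The unknowns are smooth functions with $\rho\ne0$, so that $u=m/\rho$ and the densities of $H_1^m,H_2^m$ make sense. $\frac{\delta H}{\delta\rho},\frac{\delta H}{\delta m}$ denote the variational ($L^2$) derivatives of a functional of the independent variables $(\rho,m)$. In the operator matrices, products denote composition with multiplication operators: e.g. $\partial_xu$ is $\varphi\mapsto\partial_x(u\varphi)$, $u\partial_xu$ is $\varphi\mapsto u\,\partial_x(u\varphi)$, $\rho\partial_x\rho$ is $\varphi\mapsto\rho\,\partial_x(\rho\varphi)$, etc. Anti-symmetric means formally skew-adjoint with respect to the $L^2(\mathbb{R})^2$ pairing (on smooth functions decaying at infinity). "Bi-Hamiltonian structure" means that the system can be written in the two displayed Hamiltonian forms. *)

theory Defs
  imports "HOL-Analysis.Analysis"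
begin

section \<open>Smooth functions\<close>

text \<open>
  For an open set \<open>S\<close>, \<open>Ck_on k S f\<close> says that \<open>f\<close> is \<open>k\<close> times continuously differentiable on \<open>S\<close>
  (in finite dimension: every iterated directional derivative of order at most \<open>k\<close> exists as part of
  a Frechet derivative, and those of order \<open>k\<close> are continuous).
\<close>

primrec Ck_on :: "nat \<Rightarrow> 'a::real_normed_vector set \<Rightarrow> ('a \<Rightarrow> 'b::real_normed_vector) \<Rightarrow> bool" where
  "Ck_on 0 S f \<longleftrightarrow> continuous_on S f"
| "Ck_on (Suc k) S f \<longleftrightarrow> (\<forall>x\<in>S. f differentiable (at x)) \<and>
     (\<forall>v. Ck_on k S (\<lambda>x. frechet_derivative f (at x) v))"

definition smooth_on :: "'a::real_normed_vector set \<Rightarrow> ('a \<Rightarrow> 'b::real_normed_vector) \<Rightarrow> bool" where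
  "smooth_on S f \<longleftrightarrow> (\<forall>k. Ck_on k S f)"

definition test_functions :: "(real \<Rightarrow> real) set" where
  "test_functions = {\<phi>. smooth_on UNIV \<phi> \<and> bounded {x. \<phi> x \<noteq> 0}}"

definition schwartz_functions :: "(real \<Rightarrow> real) set" where
  "schwartz_functions = {\<phi>. smooth_on UNIV \<phi> \<and>
     (\<forall>n k. bounded (range (\<lambda>x. x ^ n * (deriv ^^ k) \<phi> x)))}"

text \<open>
  The multipliers of the Schwartz space: all derivatives have at most polynomial growth.
\<close>

definition slowly_increasing :: "(real \<Rightarrow> real) \<Rightarrow> bool" where
  "slowly_increasing f \<longleftrightarrow> smooth_on UNIV f \<and>
     (\<forall>k. \<exists>n C. \<forall>x. \<bar>(deriv ^^ k) f x\<bar> \<le> C * (1 + \<bar>x\<bar>) ^ n)"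

section \<open>Variational derivatives\<close>

text \<open>
  Let \<open>F f = \<integral> \<kappa> x (f x) dx\<close> be an integral functional with density \<open>\<kappa>\<close>.  The function \<open>g\<close> is its
  \<open>L\<^sup>2\<close> derivative at \<open>f\<close> if the derivative of \<open>F (f + \<epsilon> \<phi>)\<close> at \<open>\<epsilon> = 0\<close> is \<open>\<integral> g \<phi> dx\<close> for all
  test functions \<open>\<phi>\<close>.  For a general smooth \<open>f\<close> the integral \<open>F f\<close> over the whole line may diverge, so
  the definition uses the increment \<open>F (f + \<epsilon> \<phi>) - F f\<close>, written as one integral whose integrand
  vanishes off the support of \<open>\<phi>\<close>.  If \<open>F f\<close> converges this is the literal notion; see
  \<open>has_variational_derivative_functional\<close> below.  Continuity makes \<open>g\<close> unique.
\<close>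

definition has_variational_derivative ::
  "(real \<Rightarrow> real \<Rightarrow> real) \<Rightarrow> (real \<Rightarrow> real) \<Rightarrow> (real \<Rightarrow> real) \<Rightarrow> bool" where
  "has_variational_derivative \<kappa> f g \<longleftrightarrow> continuous_on UNIV g \<and>
     (\<forall>\<phi>\<in>test_functions.
        (\<forall>\<^sub>F \<epsilon> in nhds 0. integrable lborel (\<lambda>x. \<kappa> x (f x + \<epsilon> * \<phi> x) - \<kappa> x (f x))) \<and>
        ((\<lambda>\<epsilon>. LINT x|lborel. \<kappa> x (f x + \<epsilon> * \<phi> x) - \<kappa> x (f x))
           has_real_derivative (LINT x|lborel. g x * \<phi> x)) (at 0))"

lemma has_variational_derivative_functional:
  assumes "has_variational_derivative \<kappa> f g" and "\<phi> \<in> test_functions"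
    and F: "integrable lborel (\<lambda>x. \<kappa> x (f x))"
  shows "((\<lambda>\<epsilon>. LINT x|lborel. \<kappa> x (f x + \<epsilon> * \<phi> x))
           has_real_derivative (LINT x|lborel. g x * \<phi> x)) (at 0)"
proof -
  let ?I = "\<lambda>\<epsilon>. LINT x|lborel. \<kappa> x (f x + \<epsilon> * \<phi> x) - \<kappa> x (f x)"
  have int: "\<forall>\<^sub>F \<epsilon> in nhds 0. integrable lborel (\<lambda>x. \<kappa> x (f x + \<epsilon> * \<phi> x) - \<kappa> x (f x))"
    and der: "(?I has_real_derivative (LINT x|lborel. g x * \<phi> x)) (at 0)"
    using assms unfolding has_variational_derivative_def by auto
  have "\<forall>\<^sub>F \<epsilon> in nhds 0. ?I \<epsilon> + (LINT x|lborel. \<kappa> x (f x)) = (LINT x|lborel. \<kappa> x (f x + \<epsilon> * \<phi> x))"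
    using int
  proof eventually_elim
    case (elim \<epsilon>)
    from Bochner_Integration.integral_add[OF elim F] show ?case by simp
  qed
  moreover have "((\<lambda>\<epsilon>. ?I \<epsilon> + (LINT x|lborel. \<kappa> x (f x)))
      has_real_derivative (LINT x|lborel. g x * \<phi> x)) (at 0)"
    using DERIV_add[OF der DERIV_const] by simp
  ultimately show ?thesis
    by (simp add: DERIV_cong_ev)
qed

text \<open>
  For a functional \<open>H(\<rho>, m) = \<integral> h (\<rho> x) (m x) dx\<close>, the partial variational derivatives vary one of
  the independent variables \<open>\<rho>\<close>, \<open>m\<close> and freeze the other.
\<close>

abbreviation has_delta_rho ::
  "(real \<Rightarrow> real \<Rightarrow> real) \<Rightarrow> (real \<Rightarrow> real) \<Rightarrow> (real \<Rightarrow> real) \<Rightarrow> (real \<Rightarrow> real) \<Rightarrow> bool" where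
  "has_delta_rho h \<rho> m g \<equiv> has_variational_derivative (\<lambda>x r. h r (m x)) \<rho> g"

abbreviation has_delta_m ::
  "(real \<Rightarrow> real \<Rightarrow> real) \<Rightarrow> (real \<Rightarrow> real) \<Rightarrow> (real \<Rightarrow> real) \<Rightarrow> (real \<Rightarrow> real) \<Rightarrow> bool" where
  "has_delta_m h \<rho> m g \<equiv> has_variational_derivative (\<lambda>x q. h (\<rho> x) q) m g"

section \<open>Matrix operators\<close>

type_synonym operator2 = "(real \<Rightarrow> real) \<times> (real \<Rightarrow> real) \<Rightarrow> (real \<Rightarrow> real) \<times> (real \<Rightarrow> real)"

definition L2_integrand ::
  "(real \<Rightarrow> real) \<times> (real \<Rightarrow> real) \<Rightarrow> (real \<Rightarrow> real) \<times> (real \<Rightarrow> real) \<Rightarrow> real \<Rightarrow> real" where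
  "L2_integrand \<Phi> \<Psi> x = fst \<Phi> x * fst \<Psi> x + snd \<Phi> x * snd \<Psi> x"

definition skew_adjoint_on :: "(real \<Rightarrow> real) set \<Rightarrow> operator2 \<Rightarrow> bool" where
  "skew_adjoint_on V A \<longleftrightarrow> (\<forall>\<Phi>\<in>V \<times> V. \<forall>\<Psi>\<in>V \<times> V.
     integrable lborel (L2_integrand (A \<Phi>) \<Psi>) \<and>
     integrable lborel (L2_integrand \<Phi> (A \<Psi>)) \<and>
     (LINT x|lborel. L2_integrand (A \<Phi>) \<Psi> x) = - (LINT x|lborel. L2_integrand \<Phi> (A \<Psi>) x))"

definition J_op :: "real \<Rightarrow> (real \<Rightarrow> real) \<Rightarrow> (real \<Rightarrow> real) \<Rightarrow> operator2" where
  "J_op \<alpha> \<rho> u = (\<lambda>(\<phi>, \<psi>).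
     (\<lambda>x. - (1 / \<alpha>) * deriv \<phi> x
          + (- (1 / \<alpha>) * deriv (\<lambda>y. u y * \<psi> y) x),
      \<lambda>x. - (1 / \<alpha>) * (u x * deriv \<phi> x)
          + (- (1 / \<alpha>) * (u x * deriv (\<lambda>y. u y * \<psi> y) x) - \<rho> x * deriv (\<lambda>y. \<rho> y * \<psi> y) x)))"

definition K_op :: "(real \<Rightarrow> real) \<Rightarrow> (real \<Rightarrow> real) \<Rightarrow> operator2" where
  "K_op \<rho> u = (\<lambda>(\<phi>, \<psi>).
     (\<lambda>x. - deriv (\<lambda>y. \<rho> y * \<psi> y) x,
      \<lambda>x. - \<rho> x * deriv \<phi> x
          + (- u x * deriv (\<lambda>y. \<rho> y * \<psi> y) x - \<rho> x * deriv (\<lambda>y. u y * \<psi> y) x)))"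

section \<open>Isentropic gas dynamics\<close>

text \<open>Densities of the Hamiltonians \<open>H\<^sub>1\<^sup>m\<close> and \<open>H\<^sub>2\<^sup>m\<close>, as functions of the values of \<open>\<rho>\<close> and \<open>m\<close>.\<close>

definition H1_density :: "real \<Rightarrow> real \<Rightarrow> real \<Rightarrow> real" where
  "H1_density \<alpha> r q = q ^ 3 / (6 * r ^ 3) + \<alpha> / 2 * q * r"

definition H2_density :: "real \<Rightarrow> real \<Rightarrow> real \<Rightarrow> real" where
  "H2_density \<alpha> r q = q ^ 2 / (2 * r) + \<alpha> / 6 * r ^ 3"

text \<open>Space-time fields take the time as first argument and the position as second argument.\<close>

definition isentropic_system :: "real \<Rightarrow> (real \<Rightarrow> real \<Rightarrow> real) \<Rightarrow> (real \<Rightarrow> real \<Rightarrow> real) \<Rightarrow> bool" where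
  "isentropic_system \<alpha> \<rho> u \<longleftrightarrow> (let p = (\<lambda>t x. \<alpha> / 3 * \<rho> t x ^ 3) in
     \<forall>t>0. \<forall>x.
       deriv (\<lambda>s. \<rho> s x) t + deriv (\<lambda>y. \<rho> t y * u t y) x = 0 \<and>
       deriv (\<lambda>s. \<rho> s x * u s x) t + deriv (\<lambda>y. \<rho> t y * u t y ^ 2) x + deriv (p t) x = 0)"

text \<open>
  \<open>hamiltonian_system A h \<rho> m\<close>: the variational derivatives of the functional with density \<open>h\<close> exist
  at \<open>(\<rho> t, m t)\<close>, and \<open>\<partial>\<^sub>t (\<rho>, m) = A\<^sub>t (\<delta>H/\<delta>\<rho>, \<delta>H/\<delta>m)\<close>.
\<close>

definition hamiltonian_system ::
  "(real \<Rightarrow> operator2) \<Rightarrow> (real \<Rightarrow> real \<Rightarrow> real) \<Rightarrow> (real \<Rightarrow> real \<Rightarrow> real) \<Rightarrow> (real \<Rightarrow> real \<Rightarrow> real) \<Rightarrow> bool" where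
  "hamiltonian_system A h \<rho> m \<longleftrightarrow> (\<forall>t>0. \<exists>a b.
     has_delta_rho h (\<rho> t) (m t) a \<and> has_delta_m h (\<rho> t) (m t) b \<and>
     (\<forall>x. deriv (\<lambda>s. \<rho> s x) t = fst (A t (a, b)) x \<and>
          deriv (\<lambda>s. m s x) t = snd (A t (a, b)) x))"

text \<open>
  Skew-adjointness with respect to the \<open>L\<^sup>2\<close> pairing, on functions for which the pairings converge:
  compactly supported ones for arbitrary smooth coefficients, and rapidly decaying ones when the
  coefficients are multipliers of the Schwartz space.
\<close>

definition antisymmetric_operator ::
  "((real \<Rightarrow> real) \<Rightarrow> (real \<Rightarrow> real) \<Rightarrow> operator2) \<Rightarrow> bool" where
  "antisymmetric_operator A \<longleftrightarrow> (\<forall>\<rho> u. smooth_on UNIV \<rho> \<and> smooth_on UNIV u \<longrightarrow>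
     skew_adjoint_on test_functions (A \<rho> u) \<and>
     (slowly_increasing \<rho> \<and> slowly_increasing u \<longrightarrow> skew_adjoint_on schwartz_functions (A \<rho> u)))"

end

theory Submission
  imports Defs "HOL-Probability.Sinc_Integral" "HOL-Real_Asymp.Real_Asymp"
begin

text \<open>
  With \<open>m = \<rho> u\<close> the variational derivatives of the two Hamiltonians are
  \<open>\<delta>H\<^sub>1/\<delta>\<rho> = - u\<^sup>3/(2\<rho>) + \<alpha>\<rho>u/2\<close>, \<open>\<delta>H\<^sub>1/\<delta>m = u\<^sup>2/(2\<rho>) + \<alpha>\<rho>/2\<close>, \<open>\<delta>H\<^sub>2/\<delta>\<rho> = - u\<^sup>2/2 + \<alpha>\<rho>\<^sup>2/2\<close> and
  \<open>\<delta>H\<^sub>2/\<delta>m = u\<close>: they are obtained pointwise, by differentiation under the integral sign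
  (\<open>has_variational_derivative_pointwise\<close>).  The product rule shows that both operators map their gradient
  to \<open>(- \<partial>\<^sub>x(\<rho>u), - \<partial>\<^sub>x(\<rho>u\<^sup>2) - \<partial>\<^sub>xp)\<close> (\<open>J_op_gradient_H1\<close>, \<open>K_op_gradient_H2\<close>), so that each Hamiltonian form is the
  gas dynamics system rewritten.  For the direction from a Hamiltonian form to the system, the
  variational derivatives must be unique; this is the fundamental lemma of the calculus of variations,
  which rests on smooth bump functions.

  For skew-adjointness, put \<open>w = \<phi>\<^sub>1 + u \<phi>\<^sub>2\<close>, \<open>z = \<psi>\<^sub>1 + u \<psi>\<^sub>2\<close>, \<open>p = \<rho> \<phi>\<^sub>2\<close> and \<open>q = \<rho> \<psi>\<^sub>2\<close>.  Then
  \<open>\<langle>J \<phi>, \<psi>\<rangle> = - (1/\<alpha>) \<integral> w' z - \<integral> p' q\<close> and \<open>\<langle>K \<phi>, \<psi>\<rangle> = - \<integral> p' z - \<integral> w' q\<close>, and integration by parts moves each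
  derivative to the other factor.  Integration by parts holds for Schwartz functions, hence also for
  test functions, and both classes are stable under the multiplications by \<open>\<rho>\<close> and \<open>u\<close> that occur.
\<close>

section \<open>Smooth functions of one real variable\<close>

lemma frechet_derivative_real:
  fixes f :: "real \<Rightarrow> real"
  assumes "f differentiable (at x)"
  shows "frechet_derivative f (at x) v = v * deriv f x"
proof -
  have "(f has_derivative (\<lambda>v. deriv f x * v)) (at x)"
    using assms by (simp add: DERIV_deriv_iff_real_differentiable flip: has_field_derivative_def)
  then show ?thesis
    by (simp add: frechet_derivative_at[symmetric] mult.commute)
qed

lemma Ck_on_cmult:
  fixes f :: "real \<Rightarrow> real"
  shows "Ck_on k UNIV f \<Longrightarrow> Ck_on k UNIV (\<lambda>x. c * f x)"
proof (induction k arbitrary: f)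
  case 0
  then show ?case by (auto intro: continuous_intros)
next
  case (Suc k)
  have d: "f differentiable (at x)" for x
    using Suc.prems by simp
  then have d': "(\<lambda>x. c * f x) differentiable (at x)" for x
    by (simp add: differentiable_mult)
  have "frechet_derivative (\<lambda>x. c * f x) (at x) v = c * frechet_derivative f (at x) v" for x v
  proof -
    have "(f has_real_derivative deriv f x) (at x)"
      using d by (simp add: DERIV_deriv_iff_real_differentiable)
    then have "deriv (\<lambda>x. c * f x) x = c * deriv f x"
      by (intro DERIV_imp_deriv DERIV_cmult)
    then show ?thesis
      by (simp add: frechet_derivative_real[OF d] frechet_derivative_real[OF d'])
  qed
  then show ?case
    using Suc d' by simp
qed

lemma Ck_on_Suc_real:
  fixes f :: "real \<Rightarrow> real"
  shows "Ck_on (Suc k) UNIV f \<longleftrightarrow> (\<forall>x. f differentiable (at x)) \<and> Ck_on k UNIV (deriv f)"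
proof (cases "\<forall>x. f differentiable (at x)")
  case True
  then have "(\<lambda>x. frechet_derivative f (at x) v) = (\<lambda>x. v * deriv f x)" for v
    by (simp add: frechet_derivative_real)
  then have "Ck_on (Suc k) UNIV f \<longleftrightarrow> (\<forall>v. Ck_on k UNIV (\<lambda>x. v * deriv f x))"
    using True by simp
  also have "\<dots> \<longleftrightarrow> Ck_on k UNIV (deriv f)"
  proof
    assume "\<forall>v. Ck_on k UNIV (\<lambda>x. v * deriv f x)"
    from spec[OF this, of 1] show "Ck_on k UNIV (deriv f)"
      by simp
  qed (simp add: Ck_on_cmult)
  finally show ?thesis
    using True by blast
qed auto

lemma Ck_on_SucD:
  fixes f :: "real \<Rightarrow> real"
  shows "Ck_on (Suc k) UNIV f \<Longrightarrow> Ck_on k UNIV f"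
proof (induction k arbitrary: f)
  case 0
  then show ?case
    by (simp add: continuous_on_eq_continuous_within differentiable_imp_continuous_within)
next
  case (Suc k)
  then show ?case
    unfolding Ck_on_Suc_real[of "Suc k"] Ck_on_Suc_real[of k] by blast
qed

lemma smooth_on_UNIV_iff_deriv:
  fixes f :: "real \<Rightarrow> real"
  shows "smooth_on UNIV f \<longleftrightarrow> (\<forall>x. f differentiable (at x)) \<and> smooth_on UNIV (deriv f)"
proof
  assume "smooth_on UNIV f"
  then have "Ck_on (Suc k) UNIV f" for k
    unfolding smooth_on_def by blast
  then show "(\<forall>x. f differentiable (at x)) \<and> smooth_on UNIV (deriv f)"
    unfolding smooth_on_def Ck_on_Suc_real by blast
next
  assume "(\<forall>x. f differentiable (at x)) \<and> smooth_on UNIV (deriv f)"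
  then have "Ck_on (Suc k) UNIV f" for k
    unfolding smooth_on_def Ck_on_Suc_real by blast
  then show "smooth_on UNIV f"
    unfolding smooth_on_def by (blast intro: Ck_on_SucD)
qed

lemma smooth_on_differentiable: "smooth_on UNIV f \<Longrightarrow> f differentiable (at x)"
  and smooth_on_deriv: "smooth_on UNIV f \<Longrightarrow> smooth_on UNIV (deriv f)"
  for f :: "real \<Rightarrow> real"
  using smooth_on_UNIV_iff_deriv[of f] by blast+

lemma smooth_on_DERIV:
  fixes f :: "real \<Rightarrow> real"
  shows "smooth_on UNIV f \<Longrightarrow> (f has_real_derivative deriv f x) (at x)"
  by (simp add: DERIV_deriv_iff_real_differentiable smooth_on_differentiable)

lemma smooth_on_continuous: "smooth_on UNIV f \<Longrightarrow> continuous_on A f"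
  for f :: "real \<Rightarrow> real"
  by (rule DERIV_continuous_on[OF DERIV_subset[OF smooth_on_DERIV]]) auto

lemma smooth_on_higher_deriv:
  fixes f :: "real \<Rightarrow> real"
  shows "smooth_on UNIV f \<Longrightarrow> smooth_on UNIV ((deriv ^^ k) f)"
  by (induction k) (auto intro: smooth_on_deriv)

text \<open>
  Smoothness is the largest property of functions that implies differentiability and is inherited
  by the derivative.
\<close>

lemma smooth_on_coinduct:
  fixes f :: "real \<Rightarrow> real"
  assumes "P f"
    and diff: "\<And>g x. P g \<Longrightarrow> g differentiable (at x)"
    and step: "\<And>g. P g \<Longrightarrow> P (deriv g)"
  shows "smooth_on UNIV f"
proof -
  have "P g \<Longrightarrow> Ck_on k UNIV g" for g k
  proof (induction k arbitrary: g)
    case 0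
    then show ?case
      by (simp add: continuous_on_eq_continuous_within diff differentiable_imp_continuous_within)
  next
    case (Suc k)
    then show ?case
      using diff step by (simp only: Ck_on_Suc_real) blast
  qed
  with \<open>P f\<close> show ?thesis
    by (simp add: smooth_on_def)
qed

lemma deriv_add_smooth:
  fixes f g :: "real \<Rightarrow> real"
  assumes "smooth_on UNIV f" "smooth_on UNIV g"
  shows "deriv (\<lambda>x. f x + g x) = (\<lambda>x. deriv f x + deriv g x)"
  using assms by (intro ext DERIV_imp_deriv DERIV_add smooth_on_DERIV)

lemma deriv_mult_smooth:
  fixes f g :: "real \<Rightarrow> real"
  assumes "smooth_on UNIV f" "smooth_on UNIV g"
  shows "deriv (\<lambda>x. f x * g x) = (\<lambda>x. deriv f x * g x + f x * deriv g x)"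
  using DERIV_mult[OF smooth_on_DERIV[OF assms(1)] smooth_on_DERIV[OF assms(2)]]
  by (intro ext DERIV_imp_deriv) (simp add: algebra_simps)

lemma smooth_on_add:
  fixes f g :: "real \<Rightarrow> real"
  assumes "smooth_on UNIV f" "smooth_on UNIV g"
  shows "smooth_on UNIV (\<lambda>x. f x + g x)"
proof (rule smooth_on_coinduct)
  let ?P = "\<lambda>h. \<exists>f g. smooth_on UNIV f \<and> smooth_on UNIV g \<and> h = (\<lambda>x::real. f x + g x :: real)"
  show "?P (\<lambda>x. f x + g x)"
    using assms by blast
  show "h differentiable (at x)" if "?P h" for h x
    using that smooth_on_differentiable by (auto intro!: differentiable_add)
  show "?P (deriv h)" if "?P h" for h
    using that smooth_on_deriv deriv_add_smooth by blast
qed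

lemma smooth_on_mult:
  fixes f g :: "real \<Rightarrow> real"
  assumes "smooth_on UNIV f" "smooth_on UNIV g"
  shows "smooth_on UNIV (\<lambda>x. f x * g x)"
proof -
  \<comment> \<open>The summand \<open>a\<close> absorbs one of the two products in the Leibniz rule, so that the induction goes
    through for a single product.\<close>
  have "Ck_on k UNIV (\<lambda>x. a x + f x * g x)"
    if "Ck_on k UNIV a" "smooth_on UNIV f" "smooth_on UNIV g" for a f g :: "real \<Rightarrow> real" and k
    using that
  proof (induction k arbitrary: a f g)
    case 0
    then show ?case
      using smooth_on_continuous by (auto intro!: continuous_intros)
  next
    case (Suc k)
    let ?h = "\<lambda>x. a x + f x * g x"
    have a: "\<forall>x. a differentiable (at x)" "Ck_on k UNIV (deriv a)"
      using Suc.prems(1) unfolding Ck_on_Suc_real by blast+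
    have "(a has_real_derivative deriv a x) (at x)" for x
      using a(1) by (simp add: DERIV_deriv_iff_real_differentiable)
    from DERIV_add[OF this DERIV_mult[OF smooth_on_DERIV[OF Suc.prems(2)] smooth_on_DERIV[OF Suc.prems(3)]]]
    have D: "(?h has_real_derivative (deriv a x + deriv f x * g x) + f x * deriv g x) (at x)" for x
      by (simp add: algebra_simps)
    then have "deriv ?h = (\<lambda>x. (deriv a x + deriv f x * g x) + f x * deriv g x)"
      by (intro ext DERIV_imp_deriv)
    moreover have "Ck_on k UNIV (\<lambda>x. (deriv a x + deriv f x * g x) + f x * deriv g x)"
      using Suc a(2) by (intro Suc.IH smooth_on_deriv) auto
    ultimately show ?case
      using D unfolding Ck_on_Suc_real by (auto simp: real_differentiable_def)
  qed
  moreover have "Ck_on k UNIV (\<lambda>x::real. 0 * f x)" for k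
    using assms(1) by (intro Ck_on_cmult) (simp add: smooth_on_def)
  ultimately have "Ck_on k UNIV (\<lambda>x. 0 * f x + f x * g x)" for k
    using assms by blast
  then show ?thesis
    by (simp add: smooth_on_def)
qed

lemma higher_deriv_add:
  fixes f g :: "real \<Rightarrow> real"
  assumes "smooth_on UNIV f" "smooth_on UNIV g"
  shows "(deriv ^^ k) (\<lambda>x. f x + g x) = (\<lambda>x. (deriv ^^ k) f x + (deriv ^^ k) g x)"
  by (induction k) (auto simp: deriv_add_smooth smooth_on_higher_deriv assms)

section \<open>Bump functions\<close>

lemma tendsto_poly_inverse_mult_exp:
  "((\<lambda>x::real. poly p (1 / x) * exp (- (1 / x))) \<longlongrightarrow> 0) (at_right 0)"
proof -
  have pw: "((\<lambda>y::real. y ^ n * exp (- y)) \<longlongrightarrow> 0) at_top" for n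
    using tendsto_power_div_exp_0[of n] by (simp add: exp_minus field_simps)
  have "((\<lambda>y::real. poly p y * exp (- y)) \<longlongrightarrow> 0) at_top"
  proof -
    have "((\<lambda>y::real. \<Sum>i\<le>degree p. coeff p i * (y ^ i * exp (- y))) \<longlongrightarrow> (\<Sum>i\<le>degree p. coeff p i * 0)) at_top"
      by (intro tendsto_sum tendsto_mult_left pw)
    then show ?thesis
      by (simp add: poly_altdef sum_distrib_right mult.assoc)
  qed
  then have "((\<lambda>x::real. poly p (inverse x) * exp (- inverse x)) \<longlongrightarrow> 0) (at_right 0)"
    by (rule filterlim_compose[OF _ filterlim_inverse_at_top_right])
  then show ?thesis
    by (simp add: inverse_eq_divide)
qed

text \<open>
  The classical flat functions: \<open>p(1/x) exp(-1/x)\<close> to the right of the origin, zero elsewhere.  The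
  polynomial \<open>p\<close> makes the family closed under differentiation.
\<close>

definition flat_exp :: "real poly \<Rightarrow> real \<Rightarrow> real" where
  "flat_exp p x = (if x > 0 then poly p (1 / x) * exp (- (1 / x)) else 0)"

lemma flat_exp_DERIV:
  "(flat_exp p has_real_derivative flat_exp ([:0, 0, 1:] * (p - pderiv p)) x) (at x)"
proof -
  consider "x > 0" | "x < 0" | "x = 0" by linarith
  then show ?thesis
  proof cases
    case 1
    have D: "((\<lambda>x. poly p (1 / x) * exp (- (1 / x))) has_real_derivative
        flat_exp ([:0, 0, 1:] * (p - pderiv p)) x) (at x)"
      using 1 by (auto intro!: derivative_eq_intros DERIV_chain'[OF _ poly_DERIV]
          simp: flat_exp_def field_simps power2_eq_square)
    have "eventually (\<lambda>y. flat_exp p y = poly p (1 / y) * exp (- (1 / y))) (nhds x)"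
      using eventually_nhds_in_open[of "{0<..}" x] 1
      by (auto elim!: eventually_mono simp: flat_exp_def)
    from DERIV_cong_ev[OF refl this refl] D show ?thesis
      by blast
  next
    case 2
    have "eventually (\<lambda>y. flat_exp p y = 0) (nhds x)"
      using eventually_nhds_in_open[of "{..<0}" x] 2
      by (auto elim!: eventually_mono simp: flat_exp_def)
    then have "(flat_exp p has_real_derivative 0) (at x)"
      using DERIV_cong_ev[OF refl _ refl, of "flat_exp p" "\<lambda>_. 0" x 0] by simp
    then show ?thesis
      using 2 by (simp add: flat_exp_def)
  next
    case 3
    have "((\<lambda>y. flat_exp p y / y) \<longlongrightarrow> 0) (at 0)"
    proof (rule filterlim_split_at)
      have "eventually (\<lambda>y. flat_exp p y / y = 0) (at_left (0::real))"
        by (auto simp: eventually_at_filter flat_exp_def)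
      then show "((\<lambda>y. flat_exp p y / y) \<longlongrightarrow> 0) (at_left 0)"
        by (rule tendsto_eventually)
      have "eventually (\<lambda>y. poly ([:0, 1:] * p) (1 / y) * exp (- (1 / y)) = flat_exp p y / y) (at_right (0::real))"
        by (auto simp: eventually_at_filter flat_exp_def)
      then show "((\<lambda>y. flat_exp p y / y) \<longlongrightarrow> 0) (at_right 0)"
        by (rule Lim_transform_eventually[OF tendsto_poly_inverse_mult_exp])
    qed
    then show ?thesis
      using 3 by (simp add: has_field_derivative_iff flat_exp_def)
  qed
qed

lemma smooth_on_flat_exp: "smooth_on UNIV (flat_exp p)"
proof (rule smooth_on_coinduct)
  let ?P = "\<lambda>h. \<exists>p. h = flat_exp p"
  show "?P (flat_exp p)" by blast
  show "h differentiable (at x)" if "?P h" for h x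
    using that flat_exp_DERIV real_differentiable_def by blast
  show "?P (deriv h)" if "?P h" for h
    using that DERIV_imp_deriv[OF flat_exp_DERIV] by blast
qed

lemma smooth_on_affine_compose:
  fixes f :: "real \<Rightarrow> real"
  assumes "smooth_on UNIV f"
  shows "smooth_on UNIV (\<lambda>x. f (a * x + b))"
proof -
  let ?P = "\<lambda>h. \<exists>c f. smooth_on UNIV f \<and> h = (\<lambda>x::real. c * f (a * x + b) :: real)"
  have D: "((\<lambda>x. c * f (a * x + b)) has_real_derivative (c * a) * deriv f (a * x + b)) (at x)"
    if "smooth_on UNIV f" for c x and f :: "real \<Rightarrow> real"
    by (auto intro!: derivative_eq_intros DERIV_chain'[OF _ smooth_on_DERIV[OF that]])
  have "smooth_on UNIV (\<lambda>x. 1 * f (a * x + b))"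
  proof (rule smooth_on_coinduct[of ?P])
    show "?P (\<lambda>x. 1 * f (a * x + b))"
      using assms by blast
    show "h differentiable (at x)" if "?P h" for h x
      using that D real_differentiable_def by blast
    show "?P (deriv h)" if "?P h" for h
    proof -
      obtain c f where f: "smooth_on UNIV f" "h = (\<lambda>x. c * f (a * x + b))"
        using \<open>?P h\<close> by blast
      have "deriv h = (\<lambda>x. (c * a) * deriv f (a * x + b))"
        unfolding f(2) by (intro ext DERIV_imp_deriv D f(1))
      then show ?thesis
        using smooth_on_deriv[OF f(1)] by blast
    qed
  qed
  then show ?thesis by simp
qed

lemma bump_function_exists:
  fixes a b :: real
  shows "\<exists>\<phi>\<in>test_functions. \<forall>x. \<phi> x \<ge> 0 \<and> (\<phi> x > 0 \<longleftrightarrow> a < x \<and> x < b)"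
proof (intro bexI allI conjI)
  let ?\<phi> = "\<lambda>x. flat_exp 1 (1 * x + - a) * flat_exp 1 (- 1 * x + b)"
  have "{x. ?\<phi> x \<noteq> 0} \<subseteq> {a..b}"
    by (auto simp: flat_exp_def split: if_splits)
  then have "bounded {x. ?\<phi> x \<noteq> 0}"
    by (rule bounded_subset[rotated]) simp
  then show "?\<phi> \<in> test_functions"
    unfolding test_functions_def
    using smooth_on_mult smooth_on_affine_compose smooth_on_flat_exp by blast
  show "?\<phi> x > 0 \<longleftrightarrow> a < x \<and> x < b" "?\<phi> x \<ge> 0" for x
    by (auto simp: flat_exp_def)
qed

section \<open>Variational derivatives of local functionals\<close>

lemma integral_compact_support:
  fixes h :: "real \<Rightarrow> real"
  assumes "continuous_on {a..b} h" and "\<And>x. x \<notin> {a..b} \<Longrightarrow> h x = 0"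
  shows integrable_compact_support: "integrable lborel h"
    and LINT_compact_support: "(LINT x|lborel. h x) = integral {a..b} h"
proof -
  have "(\<lambda>x. indicator {a..b} x *\<^sub>R h x) = h"
  proof
    show "indicator {a..b} x *\<^sub>R h x = h x" for x
      using assms(2)[of x] by (cases "x \<in> {a..b}") simp_all
  qed
  then show "integrable lborel h" "(LINT x|lborel. h x) = integral {a..b} h"
    using borel_integrable_atLeastAtMost'[OF assms(1)] set_borel_integral_eq_integral(2)[of "{a..b}" h]
    by (simp_all add: set_integrable_def set_lebesgue_integral_def)
qed

lemma test_function_support:
  assumes "\<phi> \<in> test_functions"
  obtains R where "R > 0" "\<And>x. x \<notin> {- R..R} \<Longrightarrow> \<phi> x = 0"
proof -
  obtain R where R: "R > 0" "\<And>x. \<phi> x \<noteq> 0 \<Longrightarrow> \<bar>x\<bar> \<le> R"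
    using assms unfolding test_functions_def bounded_pos by auto
  show ?thesis
  proof (rule that[OF R(1)])
    show "\<phi> x = 0" if "x \<notin> {- R..R}" for x
      using R(2)[of x] that by fastforce
  qed
qed

lemma test_function_continuous: "\<phi> \<in> test_functions \<Longrightarrow> continuous_on A \<phi>"
  unfolding test_functions_def by (auto intro: smooth_on_continuous)

lemma integrable_mult_test_function:
  assumes "continuous_on UNIV a" "\<phi> \<in> test_functions"
  shows "integrable lborel (\<lambda>x. a x * \<phi> x)"
proof -
  obtain R where R: "\<And>x. x \<notin> {- R..R} \<Longrightarrow> \<phi> x = 0"
    using test_function_support[OF assms(2)] by blast
  show ?thesis
  proof (rule integrable_compact_support)
    show "continuous_on {- R..R} (\<lambda>x. a x * \<phi> x)"
      by (intro continuous_on_mult test_function_continuous[OF assms(2)] continuous_on_subset[OF assms(1)]) simp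
    show "a x * \<phi> x = 0" if "x \<notin> {- R..R}" for x
      using R[OF that] by simp
  qed
qed

text \<open>The fundamental lemma of the calculus of variations.\<close>

lemma fundamental_lemma_calculus_of_variations:
  fixes a :: "real \<Rightarrow> real"
  assumes cont: "continuous_on UNIV a"
    and zero: "\<And>\<phi>. \<phi> \<in> test_functions \<Longrightarrow> (LINT x|lborel. a x * \<phi> x) = 0"
  shows "a x = 0"
proof (rule ccontr)
  assume "a x \<noteq> 0"
  define s where "s = sgn (a x)"
  have "continuous_on UNIV (\<lambda>y. s * a y)"
    using cont by (intro continuous_intros)
  moreover have pos: "s * a x > 0"
    using \<open>a x \<noteq> 0\<close> by (simp add: s_def sgn_if)
  ultimately have "open {y. s * a y > 0}"
    by (intro open_Collect_less continuous_on_const) auto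
  then obtain d where d: "d > 0" "ball x d \<subseteq> {y. s * a y > 0}"
    using pos open_contains_ball_eq by blast
  obtain \<phi> where \<phi>: "\<phi> \<in> test_functions" "\<And>y. \<phi> y > 0 \<longleftrightarrow> x - d < y \<and> y < x + d" "\<And>y. \<phi> y \<ge> 0"
    using bump_function_exists[of "x - d" "x + d"] by blast
  have zero': "\<phi> y = 0" if "y \<notin> {x - d<..<x + d}" for y
    using \<phi>(2,3)[of y] that by fastforce
  let ?h = "\<lambda>y. (s * a y) * \<phi> y"
  have nonneg: "?h y \<ge> 0" for y
  proof (cases "y \<in> {x - d<..<x + d}")
    case True
    then have "s * a y > 0"
      using d(2) by (auto simp: dist_real_def subset_eq abs_if)
    then show ?thesis using \<phi>(3)[of y] by simp
  next
    case False
    then show ?thesis by (simp add: zero')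
  qed
  have ch: "continuous_on {x - d..x + d} ?h"
    by (intro continuous_on_mult continuous_on_const test_function_continuous[OF \<phi>(1)]
        continuous_on_subset[OF cont]) simp
  have "integral {x - d..x + d} ?h = (LINT y|lborel. ?h y)"
    by (rule LINT_compact_support[symmetric, OF ch]) (use zero' in force)
  also have "\<dots> = s * (LINT y|lborel. a y * \<phi> y)"
    by (simp add: mult.assoc)
  also have "\<dots> = 0"
    by (simp add: zero[OF \<phi>(1)])
  finally have "\<forall>y\<in>{x - d..x + d}. ?h y = 0"
    using integral_eq_0_iff[OF ch] d(1) nonneg by simp
  then have "?h x = 0"
    using d(1) by auto
  moreover have "\<phi> x > 0"
    using \<phi>(2) d(1) by simp
  ultimately show False
    using pos by auto
qed

lemma has_variational_derivative_unique:
  assumes "has_variational_derivative \<kappa> f a" "has_variational_derivative \<kappa> f b"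
  shows "a = b"
proof
  fix x
  have ab: "continuous_on UNIV a" "continuous_on UNIV b"
    using assms unfolding has_variational_derivative_def by auto
  have "a x - b x = 0"
  proof (rule fundamental_lemma_calculus_of_variations[where a = "\<lambda>x. a x - b x"])
    show "continuous_on UNIV (\<lambda>x. a x - b x)"
      by (intro continuous_intros ab)
    fix \<phi> assume \<phi>: "\<phi> \<in> test_functions"
    have "(LINT x|lborel. a x * \<phi> x) = (LINT x|lborel. b x * \<phi> x)"
      using assms \<phi> unfolding has_variational_derivative_def by (blast intro: DERIV_unique)
    then show "(LINT x|lborel. (a x - b x) * \<phi> x) = 0"
      using integrable_mult_test_function[OF _ \<phi>] ab by (simp add: left_diff_distrib)
  qed
  then show "a x = b x" by simp
qed

text \<open>
  A local functional \<open>\<integral> \<kappa> x (f x) dx\<close> is differentiated pointwise.  Its density need only be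
  defined for values of \<open>f\<close> in an open set \<open>S\<close>: on the compact support of a test function \<open>\<phi>\<close> the
  perturbation \<open>f + \<epsilon> \<phi>\<close> keeps its values in \<open>S\<close> for small \<open>\<epsilon>\<close>.
\<close>

lemma has_variational_derivative_pointwise:
  fixes \<kappa> d :: "real \<Rightarrow> real \<Rightarrow> real"
  assumes S: "open S" and f: "continuous_on UNIV f" and fS: "\<And>x. f x \<in> S"
    and \<kappa>: "continuous_on (UNIV \<times> S) (\<lambda>(x, r). \<kappa> x r)"
    and d: "continuous_on (UNIV \<times> S) (\<lambda>(x, r). d x r)"
    and deriv: "\<And>x r. r \<in> S \<Longrightarrow> (\<kappa> x has_real_derivative d x r) (at r)"
  shows "has_variational_derivative \<kappa> f (\<lambda>x. d x (f x))"
  unfolding has_variational_derivative_def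
proof (intro conjI ballI)
  have [continuous_intros]: "continuous_on A (\<lambda>y. \<kappa> (g y) (h y))" "continuous_on A (\<lambda>y. d (g y) (h y))"
    if "continuous_on A g" "continuous_on A h" "\<And>y. y \<in> A \<Longrightarrow> h y \<in> S"
    for A :: "'a::topological_space set" and g h
    using continuous_on_compose2[OF \<kappa>, of A "\<lambda>y. (g y, h y)"]
      continuous_on_compose2[OF d, of A "\<lambda>y. (g y, h y)"] that
    by (auto intro: continuous_on_Pair)
  show "continuous_on UNIV (\<lambda>x. d x (f x))"
    using f fS by (intro continuous_intros)
  fix \<phi> assume \<phi>: "\<phi> \<in> test_functions"
  obtain R where R: "R > 0" "\<And>x. x \<notin> {- R..R} \<Longrightarrow> \<phi> x = 0"
    using test_function_support[OF \<phi>] by blast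
  let ?I = "{- R..R}"
  have f': "continuous_on A f" for A
    using f continuous_on_subset by blast
  have "compact (f ` ?I)"
    by (intro compact_continuous_image f' compact_Icc)
  then obtain e where e: "e > 0" "(\<Union>y\<in>f ` ?I. ball y e) \<subseteq> S"
    using compact_subset_open_imp_ball_epsilon_subset[OF _ S] fS by blast
  have "bounded (\<phi> ` ?I)"
    by (intro compact_imp_bounded compact_continuous_image test_function_continuous[OF \<phi>] compact_Icc)
  then obtain M where M: "M > 0" "\<And>x. x \<in> ?I \<Longrightarrow> \<bar>\<phi> x\<bar> \<le> M"
    unfolding bounded_pos by auto
  \<comment> \<open>For \<open>\<bar>\<epsilon>\<bar> \<le> \<delta>\<close> the perturbation is at most \<open>e / 2\<close>, within the margin \<open>e\<close> around the values of \<open>f\<close>.\<close>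
  define \<delta> where "\<delta> = e / (2 * M)"
  have \<delta>: "\<delta> > 0"
    using e M by (simp add: \<delta>_def)
  let ?U = "{- \<delta>..\<delta>}"
  have inS: "f x + \<epsilon> * \<phi> x \<in> S" if "\<epsilon> \<in> ?U" "x \<in> ?I" for \<epsilon> x
  proof -
    have "\<bar>\<epsilon> * \<phi> x\<bar> \<le> \<delta> * M"
      unfolding abs_mult using that M(2)[OF that(2)] \<delta> by (intro mult_mono) auto
    also have "\<dots> < e"
      using e M by (simp add: \<delta>_def)
    finally have "f x + \<epsilon> * \<phi> x \<in> ball (f x) e"
      by (simp add: dist_real_def)
    with that(2) e(2) show ?thesis by blast
  qed
  let ?F = "\<lambda>\<epsilon> x. \<kappa> x (f x + \<epsilon> * \<phi> x) - \<kappa> x (f x)"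
  have cF: "continuous_on ?I (?F \<epsilon>)" if "\<epsilon> \<in> ?U" for \<epsilon>
    using inS[OF that] fS by (intro continuous_intros f' test_function_continuous[OF \<phi>])
  have F0: "?F \<epsilon> x = 0" if "x \<notin> ?I" for \<epsilon> x
    using R(2)[OF that] by simp
  have evU: "eventually (\<lambda>\<epsilon>. \<epsilon> \<in> ?U) (nhds 0)"
    using eventually_nhds_in_open[of "{- \<delta><..<\<delta>}" 0] \<delta> by (auto elim!: eventually_mono)
  show "\<forall>\<^sub>F \<epsilon> in nhds 0. integrable lborel (?F \<epsilon>)"
    using evU by eventually_elim (rule integrable_compact_support[OF cF F0])
  have "((\<lambda>\<epsilon>. integral (cbox (- R) R) (?F \<epsilon>)) has_field_derivative
      integral (cbox (- R) R) (\<lambda>x. d x (f x + 0 * \<phi> x) * \<phi> x)) (at 0 within ?U)"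
  proof (rule leibniz_rule_field_derivative)
    fix \<epsilon> x assume *: "\<epsilon> \<in> ?U" "x \<in> cbox (- R) R"
    then have "(\<kappa> x has_real_derivative d x (f x + \<epsilon> * \<phi> x)) (at (f x + \<epsilon> * \<phi> x))"
      using inS by (intro deriv) auto
    moreover have "((\<lambda>\<epsilon>. f x + \<epsilon> * \<phi> x) has_real_derivative \<phi> x) (at \<epsilon> within ?U)"
      by (auto intro!: derivative_eq_intros)
    ultimately have "((\<lambda>\<epsilon>. \<kappa> x (f x + \<epsilon> * \<phi> x)) has_real_derivative d x (f x + \<epsilon> * \<phi> x) * \<phi> x) (at \<epsilon> within ?U)"
      by (rule DERIV_chain2)
    from DERIV_diff[OF this DERIV_const[of "\<kappa> x (f x)"]]
    show "((\<lambda>\<epsilon>. ?F \<epsilon> x) has_real_derivative d x (f x + \<epsilon> * \<phi> x) * \<phi> x) (at \<epsilon> within ?U)"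
      by simp
  next
    fix \<epsilon> assume "\<epsilon> \<in> ?U"
    from cF[OF this] show "?F \<epsilon> integrable_on cbox (- R) R"
      by (intro integrable_continuous) simp
  next
    have "continuous_on (?U \<times> ?I) (\<lambda>z. d (snd z) (f (snd z) + fst z * \<phi> (snd z)) * \<phi> (snd z))"
      using inS by (intro continuous_intros continuous_on_compose2[OF f]
          continuous_on_compose2[OF test_function_continuous[OF \<phi>, of UNIV]]) auto
    then show "continuous_on (?U \<times> cbox (- R) R) (\<lambda>(\<epsilon>, x). d x (f x + \<epsilon> * \<phi> x) * \<phi> x)"
      by (simp add: case_prod_unfold)
  qed (use \<delta> in auto)
  moreover have "at 0 within ?U = at (0::real)"
    using \<delta> by (intro at_within_interior) (simp add: interior_atLeastAtMost_real)
  ultimately have "((\<lambda>\<epsilon>. integral ?I (?F \<epsilon>)) has_real_derivative integral ?I (\<lambda>x. d x (f x) * \<phi> x)) (at 0)"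
    by simp
  moreover have ev: "eventually (\<lambda>\<epsilon>. (LINT x|lborel. ?F \<epsilon> x) = integral ?I (?F \<epsilon>)) (nhds 0)"
    using evU by eventually_elim (rule LINT_compact_support[OF cF F0])
  moreover have "(LINT x|lborel. d x (f x) * \<phi> x) = integral ?I (\<lambda>x. d x (f x) * \<phi> x)"
    using R(2) fS by (intro LINT_compact_support continuous_intros f' test_function_continuous[OF \<phi>]) auto
  ultimately show "((\<lambda>\<epsilon>. LINT x|lborel. ?F \<epsilon> x) has_real_derivative (LINT x|lborel. d x (f x) * \<phi> x)) (at 0)"
    using DERIV_cong_ev[OF refl ev refl] by simp
qed

section \<open>Integration by parts for rapidly decreasing functions\<close>

lemma higher_deriv_deriv: "(deriv ^^ k) (deriv f) = (deriv ^^ Suc k) f"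
  by (simp add: funpow_Suc_right del: funpow.simps)

lemma schwartz_smooth: "f \<in> schwartz_functions \<Longrightarrow> smooth_on UNIV f"
  by (simp add: schwartz_functions_def)

lemma schwartz_deriv: "f \<in> schwartz_functions \<Longrightarrow> deriv f \<in> schwartz_functions"
  unfolding schwartz_functions_def
  by (auto intro: smooth_on_deriv simp: higher_deriv_deriv simp del: funpow.simps)

lemma schwartz_add:
  assumes "f \<in> schwartz_functions" "g \<in> schwartz_functions"
  shows "(\<lambda>x. f x + g x) \<in> schwartz_functions"
proof -
  have "bounded (range (\<lambda>x. x ^ n * (deriv ^^ k) (\<lambda>x. f x + g x) x))" for n k
  proof -
    have "bounded (range (\<lambda>x. x ^ n * (deriv ^^ k) f x + x ^ n * (deriv ^^ k) g x))"
      using assms unfolding schwartz_functions_def by (auto intro: bounded_plus_comp)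
    then show ?thesis
      using assms by (simp add: higher_deriv_add schwartz_smooth distrib_left)
  qed
  then show ?thesis
    using assms by (auto simp: schwartz_functions_def intro: smooth_on_add)
qed

lemma schwartz_bound:
  assumes "f \<in> schwartz_functions"
  shows "\<exists>C>0. \<forall>x. \<bar>x ^ n * f x\<bar> \<le> C"
proof -
  have "bounded (range (\<lambda>x. x ^ n * (deriv ^^ 0) f x))"
    using assms unfolding schwartz_functions_def by blast
  then show ?thesis
    unfolding bounded_pos by auto
qed

lemma schwartz_bound_growth:
  assumes "f \<in> schwartz_functions"
  shows "\<exists>C. \<forall>x. \<bar>x ^ n * (1 + \<bar>x\<bar>) ^ N * f x\<bar> \<le> C"
proof -
  obtain C0 where C0: "C0 > 0" "\<And>x. \<bar>x ^ n * f x\<bar> \<le> C0"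
    using schwartz_bound[OF assms] by blast
  obtain C1 where C1: "C1 > 0" "\<And>x. \<bar>x ^ (n + N) * f x\<bar> \<le> C1"
    using schwartz_bound[OF assms] by blast
  have "\<bar>x ^ n * (1 + \<bar>x\<bar>) ^ N * f x\<bar> \<le> 2 ^ N * (C0 + C1)" for x
  proof -
    have "(1 + \<bar>x\<bar>) ^ N \<le> 2 ^ N * (1 + \<bar>x\<bar> ^ N)"
    proof (cases "\<bar>x\<bar> \<le> 1")
      case True
      then have "(1 + \<bar>x\<bar>) ^ N \<le> 2 ^ N"
        by (intro power_mono) auto
      then show ?thesis
        by (simp add: distrib_left add_increasing2)
    next
      case False
      then have "(1 + \<bar>x\<bar>) ^ N \<le> (2 * \<bar>x\<bar>) ^ N"
        by (intro power_mono) auto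
      then show ?thesis
        by (simp add: power_mult_distrib distrib_left add_increasing)
    qed
    then have "\<bar>x ^ n * f x\<bar> * (1 + \<bar>x\<bar>) ^ N \<le> \<bar>x ^ n * f x\<bar> * (2 ^ N * (1 + \<bar>x\<bar> ^ N))"
      by (intro mult_left_mono) auto
    also have "\<dots> = 2 ^ N * (\<bar>x ^ n * f x\<bar> + \<bar>x ^ (n + N) * f x\<bar>)"
      by (simp add: abs_mult power_abs power_add algebra_simps)
    also have "\<dots> \<le> 2 ^ N * (C0 + C1)"
      by (intro mult_left_mono add_mono C0 C1) auto
    finally show ?thesis
      by (simp add: abs_mult mult_ac)
  qed
  then show ?thesis by blast
qed

lemma slowly_increasing_deriv: "slowly_increasing f \<Longrightarrow> slowly_increasing (deriv f)"
  unfolding slowly_increasing_def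
  by (auto intro: smooth_on_deriv simp: higher_deriv_deriv simp del: funpow.simps)

lemma schwartz_mult_slowly_increasing:
  assumes "slowly_increasing \<rho>" "f \<in> schwartz_functions"
  shows "(\<lambda>x. \<rho> x * f x) \<in> schwartz_functions"
proof -
  have sm: "smooth_on UNIV \<rho>" if "slowly_increasing \<rho>" for \<rho>
    using that by (simp add: slowly_increasing_def)
  have "bounded (range (\<lambda>x. x ^ n * (deriv ^^ k) (\<lambda>x. \<rho> x * f x) x))" for n k
    using assms
  proof (induction k arbitrary: \<rho> f)
    case 0
    obtain N C where C: "\<And>x. \<bar>\<rho> x\<bar> \<le> C * (1 + \<bar>x\<bar>) ^ N"
      using 0(1) unfolding slowly_increasing_def by (metis funpow_0)
    obtain D where D: "\<And>x. \<bar>x ^ n * (1 + \<bar>x\<bar>) ^ N * f x\<bar> \<le> D"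
      using schwartz_bound_growth[OF 0(2)] by blast
    have "C \<ge> 0"
      using C[of 0] by simp
    have "\<bar>x ^ n * (\<rho> x * f x)\<bar> \<le> C * D" for x
    proof -
      have "\<bar>x ^ n * (\<rho> x * f x)\<bar> = \<bar>\<rho> x\<bar> * \<bar>x ^ n * f x\<bar>"
        by (simp add: abs_mult)
      also have "\<dots> \<le> C * (1 + \<bar>x\<bar>) ^ N * \<bar>x ^ n * f x\<bar>"
        by (intro mult_right_mono C) auto
      also have "\<dots> = C * \<bar>x ^ n * (1 + \<bar>x\<bar>) ^ N * f x\<bar>"
        by (simp add: abs_mult)
      also have "\<dots> \<le> C * D"
        by (intro mult_left_mono D \<open>C \<ge> 0\<close>)
      finally show ?thesis .
    qed
    then show ?case
      by (auto simp: bounded_iff)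
  next
    case (Suc k)
    note s = sm[OF Suc.prems(1)] schwartz_smooth[OF Suc.prems(2)]
    have "(deriv ^^ Suc k) (\<lambda>x. \<rho> x * f x) = (deriv ^^ k) (\<lambda>x. deriv \<rho> x * f x + \<rho> x * deriv f x)"
      using s by (simp add: funpow_Suc_right deriv_mult_smooth del: funpow.simps)
    also have "\<dots> = (\<lambda>x. (deriv ^^ k) (\<lambda>x. deriv \<rho> x * f x) x + (deriv ^^ k) (\<lambda>x. \<rho> x * deriv f x) x)"
      using s by (intro higher_deriv_add smooth_on_mult smooth_on_deriv)
    finally show ?case
      using bounded_plus_comp[OF Suc.IH[OF slowly_increasing_deriv[OF Suc.prems(1)] Suc.prems(2)]
          Suc.IH[OF Suc.prems(1) schwartz_deriv[OF Suc.prems(2)]]]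
      by (simp add: distrib_left)
  qed
  then show ?thesis
    using assms by (simp add: schwartz_functions_def sm smooth_on_mult)
qed

lemma schwartz_mult_bound:
  assumes "f \<in> schwartz_functions" "g \<in> schwartz_functions"
  shows "\<exists>C. \<forall>x. \<bar>f x * g x\<bar> \<le> C * inverse (1 + x\<^sup>2)"
proof -
  obtain C0 where C0: "C0 > 0" "\<And>x. \<bar>x ^ 0 * f x\<bar> \<le> C0"
    using schwartz_bound[OF assms(1)] by blast
  obtain C2 where C2: "C2 > 0" "\<And>x. \<bar>x ^ 2 * f x\<bar> \<le> C2"
    using schwartz_bound[OF assms(1)] by blast
  obtain D where D: "D > 0" "\<And>x. \<bar>x ^ 0 * g x\<bar> \<le> D"
    using schwartz_bound[OF assms(2)] by blast
  have "\<bar>f x * g x\<bar> \<le> (C0 + C2) * D * inverse (1 + x\<^sup>2)" for x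
  proof -
    have "(1 + x\<^sup>2) * \<bar>f x\<bar> * \<bar>g x\<bar> \<le> (C0 + C2) * D"
      using C0(2)[of x] C2(2)[of x] D(2)[of x] C0(1) C2(1)
      by (intro mult_mono) (auto simp: abs_mult distrib_right)
    moreover have "1 + x\<^sup>2 > 0"
      by (simp add: add_pos_nonneg)
    ultimately show ?thesis
      by (simp add: abs_mult field_simps)
  qed
  then show ?thesis by blast
qed

lemma schwartz_mult_integrable:
  assumes "f \<in> schwartz_functions" "g \<in> schwartz_functions"
  shows "integrable lborel (\<lambda>x. f x * g x)"
proof -
  obtain C where C: "\<And>x. \<bar>f x * g x\<bar> \<le> C * inverse (1 + x\<^sup>2)"
    using schwartz_mult_bound[OF assms] by blast
  have "integrable lborel (\<lambda>x::real. C * inverse (1 + x\<^sup>2))"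
    using integrable_inverse_1_plus_square by (simp add: set_integrable_def)
  then show ?thesis
  proof (rule Bochner_Integration.integrable_bound)
    have "continuous_on UNIV (\<lambda>x. f x * g x)"
      by (intro continuous_on_mult smooth_on_continuous schwartz_smooth assms)
    then show "(\<lambda>x. f x * g x) \<in> borel_measurable lborel"
      by (simp add: borel_measurable_continuous_onI)
    show "AE x in lborel. norm (f x * g x) \<le> norm (C * inverse (1 + x\<^sup>2))"
      using C by (intro AE_I2) (auto intro: order_trans[OF _ abs_ge_self])
  qed
qed

lemma schwartz_integration_by_parts:
  assumes f: "f \<in> schwartz_functions" and g: "g \<in> schwartz_functions"
  shows "(LINT x|lborel. deriv f x * g x) = - (LINT x|lborel. f x * deriv g x)"
proof -
  note int = schwartz_mult_integrable[OF schwartz_deriv[OF f] g] schwartz_mult_integrable[OF f schwartz_deriv[OF g]]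
  note sm = schwartz_smooth[OF f] schwartz_smooth[OF g]
  obtain C where C: "\<And>x. \<bar>f x * g x\<bar> \<le> C * inverse (1 + x\<^sup>2)"
    using schwartz_mult_bound[OF f g] by blast
  let ?h = "\<lambda>x. deriv f x * g x + f x * deriv g x"
  have lim: "((\<lambda>x. f x * g x) \<longlongrightarrow> 0) F" if "((\<lambda>x::real. inverse (1 + x\<^sup>2)) \<longlongrightarrow> 0) F" for F
    by (rule Lim_null_comparison[of _ "\<lambda>x. C * inverse (1 + x\<^sup>2)"])
      (use C tendsto_mult_left[OF that, of C] in simp_all)
  have sq: "filterlim (\<lambda>x::real. 1 + x\<^sup>2) at_top at_top" "filterlim (\<lambda>x::real. 1 + x\<^sup>2) at_top at_bot"
    by real_asymp+
  have "(LBINT x=-\<infinity>..\<infinity>. ?h x) = 0 - 0"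
  proof (rule interval_integral_FTC_integrable)
    show "((\<lambda>x. f x * g x) has_vector_derivative ?h x) (at x)" for x
      using DERIV_mult[OF smooth_on_DERIV[OF sm(1)] smooth_on_DERIV[OF sm(2)], of x]
      by (simp add: has_real_derivative_iff_has_vector_derivative algebra_simps)
    show "isCont ?h x" for x
    proof -
      have "continuous_on UNIV ?h"
        by (intro continuous_intros smooth_on_continuous smooth_on_deriv sm)
      then show ?thesis
        by (simp add: continuous_on_eq_continuous_at)
    qed
    show "set_integrable lborel (einterval (- \<infinity>) \<infinity>) ?h"
      using int by (simp add: set_integrable_def)
    show "(((\<lambda>x. f x * g x) \<circ> real_of_ereal) \<longlongrightarrow> 0) (at_right (- \<infinity>))"
      unfolding ereal_tendsto_simps by (intro lim tendsto_inverse_0_at_top sq)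
    show "(((\<lambda>x. f x * g x) \<circ> real_of_ereal) \<longlongrightarrow> 0) (at_left \<infinity>)"
      unfolding ereal_tendsto_simps by (intro lim tendsto_inverse_0_at_top sq)
  qed simp
  then have "(LINT x|lborel. ?h x) = 0"
    by (simp add: interval_lebesgue_integral_def set_lebesgue_integral_def)
  then show ?thesis
    using int by simp
qed

section \<open>Skew-adjointness\<close>

lemma higher_deriv_eq_0_outside:
  fixes f :: "real \<Rightarrow> real"
  assumes "\<And>x. x \<notin> {a..b} \<Longrightarrow> f x = 0" "x \<notin> {a..b}"
  shows "(deriv ^^ k) f x = 0"
  using assms(2)
proof (induction k arbitrary: x)
  case 0
  then show ?case by (simp add: assms(1))
next
  case (Suc k)
  have "eventually (\<lambda>y. y \<in> - {a..b}) (nhds x)"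
    using Suc.prems by (intro eventually_nhds_in_open open_Compl closed_atLeastAtMost) simp
  then have "eventually (\<lambda>y. (deriv ^^ k) f y = 0) (nhds x)"
    by eventually_elim (rule Suc.IH, simp)
  from deriv_cong_ev[OF this refl] show ?case
    by simp
qed

lemma test_functions_subset_schwartz: "test_functions \<subseteq> schwartz_functions"
proof
  fix \<phi> assume \<phi>: "\<phi> \<in> test_functions"
  then have sm: "smooth_on UNIV \<phi>"
    by (simp add: test_functions_def)
  obtain R where R: "\<And>x. x \<notin> {- R..R} \<Longrightarrow> \<phi> x = 0"
    using test_function_support[OF \<phi>] by blast
  have "bounded (range (\<lambda>x. x ^ n * (deriv ^^ k) \<phi> x))" for n k
  proof (rule bounded_subset)
    let ?h = "\<lambda>x. x ^ n * (deriv ^^ k) \<phi> x"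
    have "compact (?h ` {- R..R})"
      by (intro compact_continuous_image continuous_intros smooth_on_continuous
          smooth_on_higher_deriv sm compact_Icc)
    then show "bounded (insert 0 (?h ` {- R..R}))"
      by (simp add: compact_imp_bounded)
    have "?h x \<in> insert 0 (?h ` {- R..R})" for x
      using higher_deriv_eq_0_outside[of "- R" R \<phi> x k, OF R] by (cases "x \<in> {- R..R}") auto
    then show "range ?h \<subseteq> insert 0 (?h ` {- R..R})"
      by blast
  qed
  with sm show "\<phi> \<in> schwartz_functions"
    by (simp add: schwartz_functions_def)
qed

lemma test_function_add:
  assumes "f \<in> test_functions" "g \<in> test_functions"
  shows "(\<lambda>x. f x + g x) \<in> test_functions"
proof -
  have "bounded ({x. f x \<noteq> 0} \<union> {x. g x \<noteq> 0})"
    using assms by (simp add: test_functions_def)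
  then have "bounded {x. f x + g x \<noteq> 0}"
    by (rule bounded_subset) auto
  then show ?thesis
    using assms by (simp add: test_functions_def smooth_on_add)
qed

lemma test_function_mult:
  assumes "smooth_on UNIV \<rho>" "f \<in> test_functions"
  shows "(\<lambda>x. \<rho> x * f x) \<in> test_functions"
proof -
  have "bounded {x. f x \<noteq> 0}"
    using assms by (simp add: test_functions_def)
  then have "bounded {x. \<rho> x * f x \<noteq> 0}"
    by (rule bounded_subset) auto
  then show ?thesis
    using assms by (simp add: test_functions_def smooth_on_mult)
qed

text \<open>
  Let \<open>M\<close> and \<open>N\<close> be the row operators \<open>M (\<phi>, \<psi>) = \<phi> + u \<psi>\<close> and \<open>N (\<phi>, \<psi>) = \<rho> \<psi>\<close>.  The operator \<open>J_op\<close> is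
  \<open>- (1/\<alpha>) M\<^sup>T \<partial>\<^sub>x M - N\<^sup>T \<partial>\<^sub>x N\<close>, and \<open>K_op\<close> is \<open>- M\<^sup>T \<partial>\<^sub>x N - N\<^sup>T \<partial>\<^sub>x M\<close>; both inherit skew-adjointness from
  \<open>\<partial>\<^sub>x\<close>.  In the proof \<open>w = M \<Phi>\<close>, \<open>z = M \<Psi>\<close>, \<open>p = N \<Phi>\<close> and \<open>q = N \<Psi>\<close>.
\<close>

lemma
  assumes V: "V \<subseteq> schwartz_functions"
    and add: "\<And>f g. f \<in> V \<Longrightarrow> g \<in> V \<Longrightarrow> (\<lambda>x. f x + g x) \<in> V"
    and \<rho>: "\<And>f. f \<in> V \<Longrightarrow> (\<lambda>x. \<rho> x * f x) \<in> V"
    and u: "\<And>f. f \<in> V \<Longrightarrow> (\<lambda>x. u x * f x) \<in> V"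
  shows skew_adjoint_on_J_op: "skew_adjoint_on V (J_op \<alpha> \<rho> u)"
    and skew_adjoint_on_K_op: "skew_adjoint_on V (K_op \<rho> u)"
proof -
  have
    "(integrable lborel (L2_integrand (J_op \<alpha> \<rho> u \<Phi>) \<Psi>) \<and>
     integrable lborel (L2_integrand \<Phi> (J_op \<alpha> \<rho> u \<Psi>)) \<and>
     (LINT x|lborel. L2_integrand (J_op \<alpha> \<rho> u \<Phi>) \<Psi> x) = - (LINT x|lborel. L2_integrand \<Phi> (J_op \<alpha> \<rho> u \<Psi>) x)) \<and>
     (integrable lborel (L2_integrand (K_op \<rho> u \<Phi>) \<Psi>) \<and>
     integrable lborel (L2_integrand \<Phi> (K_op \<rho> u \<Psi>)) \<and>
     (LINT x|lborel. L2_integrand (K_op \<rho> u \<Phi>) \<Psi> x) = - (LINT x|lborel. L2_integrand \<Phi> (K_op \<rho> u \<Psi>) x))"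
    if \<Phi>\<Psi>: "\<Phi> \<in> V \<times> V" "\<Psi> \<in> V \<times> V" for \<Phi> \<Psi>
  proof -
    obtain \<phi>1 \<phi>2 where \<Phi>: "\<Phi> = (\<phi>1, \<phi>2)" "\<phi>1 \<in> V" "\<phi>2 \<in> V"
      using \<Phi>\<Psi>(1) by auto
    obtain \<psi>1 \<psi>2 where \<Psi>: "\<Psi> = (\<psi>1, \<psi>2)" "\<psi>1 \<in> V" "\<psi>2 \<in> V"
      using \<Phi>\<Psi>(2) by auto
    define w z p q where wzpq: "w = (\<lambda>x. \<phi>1 x + u x * \<phi>2 x)" "z = (\<lambda>x. \<psi>1 x + u x * \<psi>2 x)"
      "p = (\<lambda>x. \<rho> x * \<phi>2 x)" "q = (\<lambda>x. \<rho> x * \<psi>2 x)"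
    have "w \<in> V" "z \<in> V" "p \<in> V" "q \<in> V"
      unfolding wzpq by (intro add \<rho> u \<Phi> \<Psi>)+
    with V have S: "w \<in> schwartz_functions" "z \<in> schwartz_functions"
      "p \<in> schwartz_functions" "q \<in> schwartz_functions"
      by auto
    have "deriv w = (\<lambda>x. deriv \<phi>1 x + deriv (\<lambda>y. u y * \<phi>2 y) x)"
      unfolding wzpq using V u \<Phi> by (intro deriv_add_smooth schwartz_smooth) auto
    then have w': "deriv (\<lambda>y. u y * \<phi>2 y) x = deriv w x - deriv \<phi>1 x" for x
      by simp
    have "deriv z = (\<lambda>x. deriv \<psi>1 x + deriv (\<lambda>y. u y * \<psi>2 y) x)"
      unfolding wzpq using V u \<Psi> by (intro deriv_add_smooth schwartz_smooth) auto
    then have z': "deriv (\<lambda>y. u y * \<psi>2 y) x = deriv z x - deriv \<psi>1 x" for x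
      by simp
    have comps: "w x = \<phi>1 x + u x * \<phi>2 x" "z x = \<psi>1 x + u x * \<psi>2 x"
      "p x = \<rho> x * \<phi>2 x" "q x = \<rho> x * \<psi>2 x" for x
      by (simp_all add: wzpq)
    have J: "L2_integrand (J_op \<alpha> \<rho> u \<Phi>) \<Psi> = (\<lambda>x. - (1 / \<alpha>) * (deriv w x * z x) - deriv p x * q x)"
      "L2_integrand \<Phi> (J_op \<alpha> \<rho> u \<Psi>) = (\<lambda>x. - (1 / \<alpha>) * (w x * deriv z x) - p x * deriv q x)"
      unfolding L2_integrand_def J_op_def \<Phi>(1) \<Psi>(1) prod.case fst_conv snd_conv w' z' wzpq(3,4)[symmetric]
      by (simp_all add: fun_eq_iff comps algebra_simps add_divide_distrib diff_divide_distrib)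
    have K: "L2_integrand (K_op \<rho> u \<Phi>) \<Psi> = (\<lambda>x. - (deriv p x * z x) - deriv w x * q x)"
      "L2_integrand \<Phi> (K_op \<rho> u \<Psi>) = (\<lambda>x. - (w x * deriv q x) - p x * deriv z x)"
      unfolding L2_integrand_def K_op_def \<Phi>(1) \<Psi>(1) prod.case fst_conv snd_conv w' z' wzpq(3,4)[symmetric]
      by (simp_all add: fun_eq_iff comps algebra_simps)
    have int: "integrable lborel (\<lambda>x. deriv f x * g x)" "integrable lborel (\<lambda>x. f x * deriv g x)"
      if "f \<in> schwartz_functions" "g \<in> schwartz_functions" for f g
      using that by (auto intro: schwartz_mult_integrable schwartz_deriv)
    note ibp = schwartz_integration_by_parts
    show ?thesis
      unfolding J K using S by (simp add: int ibp[of w z] ibp[of p q] ibp[of p z] ibp[of w q])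
  qed
  then show "skew_adjoint_on V (J_op \<alpha> \<rho> u)" "skew_adjoint_on V (K_op \<rho> u)"
    unfolding skew_adjoint_on_def by blast+
qed

lemma antisymmetric_operator_J_op: "antisymmetric_operator (J_op \<alpha>)"
  and antisymmetric_operator_K_op: "antisymmetric_operator K_op"
  unfolding antisymmetric_operator_def
  by (auto intro!: skew_adjoint_on_J_op skew_adjoint_on_K_op test_functions_subset_schwartz
      intro: test_function_add test_function_mult schwartz_add schwartz_mult_slowly_increasing)

section \<open>The two Hamiltonian forms\<close>

text \<open>
  In the next two lemmas the second argument of the functional is \<open>m = r u\<close>, and the derivatives are
  written in terms of \<open>r\<close> and \<open>u\<close>.
\<close>

lemma has_delta_H1:
  assumes "continuous_on UNIV r" "continuous_on UNIV u" "\<And>x. r x \<noteq> 0"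
  shows "has_delta_rho (H1_density \<alpha>) r (\<lambda>x. r x * u x)
      (\<lambda>x. - (u x ^ 3 / (2 * r x)) + \<alpha> / 2 * (r x * u x))" (is ?rho)
    and "has_delta_m (H1_density \<alpha>) r (\<lambda>x. r x * u x)
      (\<lambda>x. u x ^ 2 / (2 * r x) + \<alpha> / 2 * r x)" (is ?m)
proof -
  have c: "continuous_on A (\<lambda>z. r (fst z))" "continuous_on A (\<lambda>z. u (fst z))" for A :: "(real \<times> real) set"
    by (auto intro!: continuous_on_compose2[OF assms(1)] continuous_on_compose2[OF assms(2)] continuous_intros)
  have "has_delta_rho (H1_density \<alpha>) r (\<lambda>x. r x * u x)
      (\<lambda>x. - ((r x * u x) ^ 3 / (2 * r x ^ 4)) + \<alpha> / 2 * (r x * u x))"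
  proof (rule has_variational_derivative_pointwise[where S = "- {0}"
        and d = "\<lambda>x s. - ((r x * u x) ^ 3 / (2 * s ^ 4)) + \<alpha> / 2 * (r x * u x)"])
    show "((\<lambda>s. H1_density \<alpha> s (r x * u x)) has_real_derivative
        - ((r x * u x) ^ 3 / (2 * s ^ 4)) + \<alpha> / 2 * (r x * u x)) (at s)" if "s \<in> - {0}" for x s
      unfolding H1_density_def using that
      by (auto intro!: derivative_eq_intros simp: field_simps eval_nat_numeral)
  qed (use assms in \<open>auto simp: H1_density_def case_prod_unfold intro!: continuous_intros c\<close>)
  then show ?rho
    using assms(3) by (simp add: power_mult_distrib eval_nat_numeral)
  have "has_delta_m (H1_density \<alpha>) r (\<lambda>x. r x * u x)
      (\<lambda>x. (r x * u x) ^ 2 / (2 * r x ^ 3) + \<alpha> / 2 * r x)"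
  proof (rule has_variational_derivative_pointwise[where S = UNIV
        and d = "\<lambda>x q. q ^ 2 / (2 * r x ^ 3) + \<alpha> / 2 * r x"])
    show "(H1_density \<alpha> (r x) has_real_derivative q ^ 2 / (2 * r x ^ 3) + \<alpha> / 2 * r x) (at q)" for x q
      unfolding H1_density_def using assms(3)[of x]
      by (auto intro!: derivative_eq_intros simp: field_simps)
  qed (use assms in \<open>auto simp: H1_density_def case_prod_unfold intro!: continuous_intros c\<close>)
  then show ?m
    using assms(3) by (simp add: power_mult_distrib eval_nat_numeral)
qed

lemma has_delta_H2:
  assumes "continuous_on UNIV r" "continuous_on UNIV u" "\<And>x. r x \<noteq> 0"
  shows "has_delta_rho (H2_density \<alpha>) r (\<lambda>x. r x * u x)
      (\<lambda>x. - (u x ^ 2 / 2) + \<alpha> / 2 * r x ^ 2)" (is ?rho)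
    and "has_delta_m (H2_density \<alpha>) r (\<lambda>x. r x * u x) u" (is ?m)
proof -
  have c: "continuous_on A (\<lambda>z. r (fst z))" "continuous_on A (\<lambda>z. u (fst z))" for A :: "(real \<times> real) set"
    by (auto intro!: continuous_on_compose2[OF assms(1)] continuous_on_compose2[OF assms(2)] continuous_intros)
  have "has_delta_rho (H2_density \<alpha>) r (\<lambda>x. r x * u x)
      (\<lambda>x. - ((r x * u x) ^ 2 / (2 * r x ^ 2)) + \<alpha> / 2 * r x ^ 2)"
  proof (rule has_variational_derivative_pointwise[where S = "- {0}"
        and d = "\<lambda>x s. - ((r x * u x) ^ 2 / (2 * s ^ 2)) + \<alpha> / 2 * s ^ 2"])
    show "((\<lambda>s. H2_density \<alpha> s (r x * u x)) has_real_derivative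
        - ((r x * u x) ^ 2 / (2 * s ^ 2)) + \<alpha> / 2 * s ^ 2) (at s)" if "s \<in> - {0}" for x s
      unfolding H2_density_def using that
      by (auto intro!: derivative_eq_intros simp: field_simps eval_nat_numeral)
  qed (use assms in \<open>auto simp: H2_density_def case_prod_unfold intro!: continuous_intros c\<close>)
  then show ?rho
    using assms(3) by (simp add: power_mult_distrib)
  have "has_delta_m (H2_density \<alpha>) r (\<lambda>x. r x * u x) (\<lambda>x. r x * u x / r x)"
  proof (rule has_variational_derivative_pointwise[where S = UNIV and d = "\<lambda>x q. q / r x"])
    show "(H2_density \<alpha> (r x) has_real_derivative q / r x) (at q)" for x q
      unfolding H2_density_def using assms(3)[of x]
      by (auto intro!: derivative_eq_intros simp: field_simps)
  qed (use assms in \<open>auto simp: H2_density_def case_prod_unfold intro!: continuous_intros c\<close>)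
  then show ?m
    using assms(3) by simp
qed

text \<open>
  Applied to the gradient of its Hamiltonian, either operator produces the negative \<open>x\<close>-derivatives of
  the fluxes of mass and momentum, whether or not \<open>r\<close> and \<open>u\<close> evolve by the gas dynamics equations.
\<close>

lemma
  fixes r u :: "real \<Rightarrow> real"
  assumes r: "\<And>x. r differentiable (at x)" and u: "\<And>x. u differentiable (at x)"
    and nz: "\<And>x. r x \<noteq> 0"
  shows J_op_gradient_H1: "\<alpha> \<noteq> 0 \<Longrightarrow>
      J_op \<alpha> r u (\<lambda>x. - (u x ^ 3 / (2 * r x)) + \<alpha> / 2 * (r x * u x), \<lambda>x. u x ^ 2 / (2 * r x) + \<alpha> / 2 * r x) =
      (\<lambda>x. - deriv (\<lambda>y. r y * u y) x,
       \<lambda>x. - deriv (\<lambda>y. r y * u y ^ 2) x - deriv (\<lambda>y. \<alpha> / 3 * r y ^ 3) x)"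
    and K_op_gradient_H2: "K_op r u (\<lambda>x. - (u x ^ 2 / 2) + \<alpha> / 2 * r x ^ 2, u) =
      (\<lambda>x. - deriv (\<lambda>y. r y * u y) x,
       \<lambda>x. - deriv (\<lambda>y. r y * u y ^ 2) x - deriv (\<lambda>y. \<alpha> / 3 * r y ^ 3) x)"
proof -
  have r': "(r has_real_derivative deriv r x) (at x)" and u': "(u has_real_derivative deriv u x) (at x)" for x
    using r u by (simp_all add: DERIV_deriv_iff_real_differentiable)
  have ru: "deriv (\<lambda>y. r y * u y) x = deriv r x * u x + r x * deriv u x" for x
    by (rule DERIV_imp_deriv) (auto intro!: derivative_eq_intros r' u')
  have ruu: "deriv (\<lambda>y. r y * u y ^ 2) x = deriv r x * u x ^ 2 + 2 * r x * u x * deriv u x" for x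
    by (rule DERIV_imp_deriv) (auto intro!: derivative_eq_intros r' u')
  have p: "deriv (\<lambda>y. \<alpha> / 3 * r y ^ 3) x = \<alpha> * r x ^ 2 * deriv r x" for x
    by (rule DERIV_imp_deriv) (auto intro!: derivative_eq_intros r' u')
  have a2: "deriv (\<lambda>x. - (u x ^ 2 / 2) + \<alpha> / 2 * r x ^ 2) x = - (u x * deriv u x) + \<alpha> * r x * deriv r x" for x
    by (rule DERIV_imp_deriv) (auto intro!: derivative_eq_intros r' u')
  have uu: "deriv (\<lambda>y. u y * u y) x = 2 * u x * deriv u x" for x
    by (rule DERIV_imp_deriv) (auto intro!: derivative_eq_intros r' u')
  show "K_op r u (\<lambda>x. - (u x ^ 2 / 2) + \<alpha> / 2 * r x ^ 2, u) =
      (\<lambda>x. - deriv (\<lambda>y. r y * u y) x,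
       \<lambda>x. - deriv (\<lambda>y. r y * u y ^ 2) x - deriv (\<lambda>y. \<alpha> / 3 * r y ^ 3) x)"
    unfolding K_op_def prod.case ru ruu p a2 uu
    by (simp add: fun_eq_iff power2_eq_square algebra_simps)
  assume \<alpha>: "\<alpha> \<noteq> 0"
  have a: "deriv (\<lambda>x. - (u x ^ 3 / (2 * r x)) + \<alpha> / 2 * (r x * u x)) x =
      - (3 * u x ^ 2 * deriv u x / (2 * r x)) + u x ^ 3 * deriv r x / (2 * r x ^ 2)
      + \<alpha> / 2 * (deriv r x * u x + r x * deriv u x)" for x
    by (rule DERIV_imp_deriv, (rule derivative_eq_intros r' u' refl | simp add: nz)+)
      (simp add: nz field_simps eval_nat_numeral)
  have b: "deriv (\<lambda>y. u y * (u y ^ 2 / (2 * r y) + \<alpha> / 2 * r y)) x =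
      3 * u x ^ 2 * deriv u x / (2 * r x) - u x ^ 3 * deriv r x / (2 * r x ^ 2)
      + \<alpha> / 2 * (deriv r x * u x + r x * deriv u x)" for x
    by (rule DERIV_imp_deriv, (rule derivative_eq_intros r' u' refl | simp add: nz)+)
      (simp add: nz field_simps eval_nat_numeral)
  \<comment> \<open>The quotient is removed before differentiating, as \<open>r\<close> cancels.\<close>
  have "(\<lambda>y. r y * (u y ^ 2 / (2 * r y) + \<alpha> / 2 * r y)) = (\<lambda>y. u y ^ 2 / 2 + \<alpha> / 2 * r y ^ 2)"
    using nz by (simp add: distrib_left power2_eq_square fun_eq_iff)
  moreover have "deriv (\<lambda>y. u y ^ 2 / 2 + \<alpha> / 2 * r y ^ 2) x = u x * deriv u x + \<alpha> * r x * deriv r x" for x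
    by (rule DERIV_imp_deriv) (auto intro!: derivative_eq_intros r' u')
  ultimately have c: "deriv (\<lambda>y. r y * (u y ^ 2 / (2 * r y) + \<alpha> / 2 * r y)) x = u x * deriv u x + \<alpha> * r x * deriv r x" for x
    by simp
  have ab: "- (1 / \<alpha>) * deriv (\<lambda>x. - (u x ^ 3 / (2 * r x)) + \<alpha> / 2 * (r x * u x)) x
      + - (1 / \<alpha>) * deriv (\<lambda>y. u y * (u y ^ 2 / (2 * r y) + \<alpha> / 2 * r y)) x
      = - deriv (\<lambda>y. r y * u y) x" for x
    unfolding a b ru using \<alpha> by (simp add: field_simps)
  have ab': "- (1 / \<alpha>) * (u x * deriv (\<lambda>x. - (u x ^ 3 / (2 * r x)) + \<alpha> / 2 * (r x * u x)) x)
      + (- (1 / \<alpha>) * (u x * deriv (\<lambda>y. u y * (u y ^ 2 / (2 * r y) + \<alpha> / 2 * r y)) x) - k)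
      = - (u x * deriv (\<lambda>y. r y * u y) x) - k" for x k
    using arg_cong[OF ab[of x], of "\<lambda>v. u x * v"] by (simp add: algebra_simps)
  show "J_op \<alpha> r u (\<lambda>x. - (u x ^ 3 / (2 * r x)) + \<alpha> / 2 * (r x * u x), \<lambda>x. u x ^ 2 / (2 * r x) + \<alpha> / 2 * r x) =
      (\<lambda>x. - deriv (\<lambda>y. r y * u y) x,
       \<lambda>x. - deriv (\<lambda>y. r y * u y ^ 2) x - deriv (\<lambda>y. \<alpha> / 3 * r y ^ 3) x)"
    unfolding J_op_def prod.case ab ab' c ru ruu p
    by (simp add: fun_eq_iff power2_eq_square algebra_simps)
qed

text \<open>
  Since variational derivatives are unique, the existential quantifiers in a Hamiltonian system may be
  replaced by known derivatives.
\<close>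

lemma hamiltonian_system_iff:
  assumes "\<And>t. t > 0 \<Longrightarrow> has_delta_rho h (\<rho> t) (m t) (a t)"
    and "\<And>t. t > 0 \<Longrightarrow> has_delta_m h (\<rho> t) (m t) (b t)"
  shows "hamiltonian_system A h \<rho> m \<longleftrightarrow>
    (\<forall>t>0. \<forall>x. deriv (\<lambda>s. \<rho> s x) t = fst (A t (a t, b t)) x \<and>
          deriv (\<lambda>s. m s x) t = snd (A t (a t, b t)) x)"
proof -
  have "(\<exists>a' b'. has_delta_rho h (\<rho> t) (m t) a' \<and> has_delta_m h (\<rho> t) (m t) b' \<and> P a' b') \<longleftrightarrow> P (a t) (b t)"
    if "t > 0" for t P
    using assms[OF that] by (blast dest: has_variational_derivative_unique)
  then show ?thesis
    unfolding hamiltonian_system_def by simp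
qed

lemma differentiable_space_slice:
  fixes f :: "real \<Rightarrow> real \<Rightarrow> real"
  assumes "smooth_on ({0<..} \<times> UNIV) (\<lambda>(t, x). f t x)" "t > 0"
  shows "f t differentiable (at x)"
proof -
  have "Ck_on (Suc 0) ({0<..} \<times> UNIV) (\<lambda>(t, x). f t x)"
    using assms(1) by (simp only: smooth_on_def)
  then have "(\<lambda>(t, x). f t x) differentiable (at (t, x))"
    using assms(2) by simp
  moreover have "(\<lambda>x. (t, x)) differentiable (at x)"
    by (auto intro!: derivative_eq_intros simp: differentiable_def)
  ultimately have "((\<lambda>(t, x). f t x) \<circ> (\<lambda>x. (t, x))) differentiable (at x)"
    by (intro differentiable_chain_at) auto
  then show ?thesis
    by (simp add: o_def)
qed

theorem corollary3p1:
  fixes \<alpha> :: real and \<rho> u m :: "real \<Rightarrow> real \<Rightarrow> real"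
  assumes "\<alpha> \<noteq> 0"
    and "smooth_on ({0<..} \<times> UNIV) (\<lambda>(t, x). \<rho> t x)"
    and "smooth_on ({0<..} \<times> UNIV) (\<lambda>(t, x). u t x)"
    and "\<And>t x. t > 0 \<Longrightarrow> \<rho> t x \<noteq> 0"
    and "\<And>t x. t > 0 \<Longrightarrow> m t x = \<rho> t x * u t x"
  shows "(isentropic_system \<alpha> \<rho> u
            \<longleftrightarrow> hamiltonian_system (\<lambda>t. J_op \<alpha> (\<rho> t) (u t)) (H1_density \<alpha>) \<rho> m)
       \<and> (isentropic_system \<alpha> \<rho> u
            \<longleftrightarrow> hamiltonian_system (\<lambda>t. K_op (\<rho> t) (u t)) (H2_density \<alpha>) \<rho> m)
       \<and> antisymmetric_operator (J_op \<alpha>)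
       \<and> antisymmetric_operator K_op"
proof (intro conjI antisymmetric_operator_J_op antisymmetric_operator_K_op)
  have diff: "\<rho> t differentiable (at x)" "u t differentiable (at x)" if "t > 0" for t x
    using assms(2,3) that by (auto intro: differentiable_space_slice)
  have cont: "continuous_on UNIV (\<rho> t)" "continuous_on UNIV (u t)" if "t > 0" for t
    using diff[OF that] by (auto simp: continuous_on_eq_continuous_at intro: differentiable_imp_continuous_within)
  have m: "m t = (\<lambda>x. \<rho> t x * u t x)" if "t > 0" for t
    using assms(5)[OF that] by blast
  have m_deriv: "deriv (\<lambda>s. m s x) t = deriv (\<lambda>s. \<rho> s x * u s x) t" if "t > 0" for t x
  proof (rule deriv_cong_ev[OF _ refl])
    have "eventually (\<lambda>s. s \<in> {0<..}) (nhds t)"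
      using that by (intro eventually_nhds_in_open) auto
    then show "eventually (\<lambda>s. m s x = \<rho> s x * u s x) (nhds t)"
      by eventually_elim (simp add: assms(5))
  qed
  have system: "isentropic_system \<alpha> \<rho> u \<longleftrightarrow>
    (\<forall>t>0. \<forall>x. deriv (\<lambda>s. \<rho> s x) t = - deriv (\<lambda>y. \<rho> t y * u t y) x \<and>
      deriv (\<lambda>s. m s x) t = - deriv (\<lambda>y. \<rho> t y * u t y ^ 2) x - deriv (\<lambda>y. \<alpha> / 3 * \<rho> t y ^ 3) x)"
    unfolding isentropic_system_def Let_def
    by (intro all_cong1 imp_cong refl conj_cong) (auto simp: m_deriv)
  show "isentropic_system \<alpha> \<rho> u
      \<longleftrightarrow> hamiltonian_system (\<lambda>t. J_op \<alpha> (\<rho> t) (u t)) (H1_density \<alpha>) \<rho> m"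
  proof -
    have "hamiltonian_system (\<lambda>t. J_op \<alpha> (\<rho> t) (u t)) (H1_density \<alpha>) \<rho> m \<longleftrightarrow>
      (\<forall>t>0. \<forall>x.
        deriv (\<lambda>s. \<rho> s x) t = fst (J_op \<alpha> (\<rho> t) (u t)
          (\<lambda>x. - (u t x ^ 3 / (2 * \<rho> t x)) + \<alpha> / 2 * (\<rho> t x * u t x), \<lambda>x. u t x ^ 2 / (2 * \<rho> t x) + \<alpha> / 2 * \<rho> t x)) x \<and>
        deriv (\<lambda>s. m s x) t = snd (J_op \<alpha> (\<rho> t) (u t)
          (\<lambda>x. - (u t x ^ 3 / (2 * \<rho> t x)) + \<alpha> / 2 * (\<rho> t x * u t x), \<lambda>x. u t x ^ 2 / (2 * \<rho> t x) + \<alpha> / 2 * \<rho> t x)) x)"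
      by (rule hamiltonian_system_iff) (simp_all only: m has_delta_H1 cont assms(4) not_False_eq_True)
    also have "\<dots> \<longleftrightarrow> isentropic_system \<alpha> \<rho> u"
      unfolding system
      by (intro all_cong1 imp_cong refl) (simp only: J_op_gradient_H1 diff assms(1,4) fst_conv snd_conv not_False_eq_True)
    finally show ?thesis ..
  qed
  show "isentropic_system \<alpha> \<rho> u
      \<longleftrightarrow> hamiltonian_system (\<lambda>t. K_op (\<rho> t) (u t)) (H2_density \<alpha>) \<rho> m"
  proof -
    have "hamiltonian_system (\<lambda>t. K_op (\<rho> t) (u t)) (H2_density \<alpha>) \<rho> m \<longleftrightarrow>
      (\<forall>t>0. \<forall>x.
        deriv (\<lambda>s. \<rho> s x) t = fst (K_op (\<rho> t) (u t) (\<lambda>x. - (u t x ^ 2 / 2) + \<alpha> / 2 * \<rho> t x ^ 2, u t)) x \<and>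
        deriv (\<lambda>s. m s x) t = snd (K_op (\<rho> t) (u t) (\<lambda>x. - (u t x ^ 2 / 2) + \<alpha> / 2 * \<rho> t x ^ 2, u t)) x)"
      by (rule hamiltonian_system_iff) (simp_all only: m has_delta_H2 cont assms(4) not_False_eq_True)
    also have "\<dots> \<longleftrightarrow> isentropic_system \<alpha> \<rho> u"
      unfolding system
      by (intro all_cong1 imp_cong refl) (simp only: K_op_gradient_H2 diff assms(4) fst_conv snd_conv not_False_eq_True)
    finally show ?thesis ..
  qed
qed

end
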